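(* Consider the truncated least squares (TLS) problem $$f^\star=\min_{x\in\mathcal X}\ \sum_{i=1}^N\min\Big\{\frac{r^2(x,y_i)}{\beta_i^2},\ \bar c^2\Big\},$$ where the domain $\mathcal X$ and the residual function $r$ are those of any one of the four problems: single rotation averaging, shape alignment, point cloud registration, mesh registration (defined in the context). This problem is equivalent (in the sense given in the context) to a polynomial optimization problem (POP) $$f^\star=\min_{p\in\mathbb R^{\tilde n}} f(p)\quad\text{s.t.}\quad h_j(p)=0,\ j=1,\dots,l_h,\qquad 1\ge g_k(p)\ge 0,\ k=1,\dots,l_g,$$ with $\tilde n=n+N$ and $p=[x^{\mathsf T},\theta^{\mathsf T}]^{\mathsf T}\in\mathbb R^{\tilde n}$, where $x\in\mathbb R^n$ contains the geometric model to be estimated and $\theta\in\{\pm1\}^N$ is a vector of binary variables such that $\theta_i=+1$ (resp. $\theta_i=-1$) when the $i$-th measurement $y_i$ is estimated to be an inlier (resp. outlier). Here $f$ is a real polynomial in $p$ with $\deg f\le 3$, and $h_j,g_k$ are quadratic (degree-2) polynomials in $p$ that define the domains of $x$ and of $\theta$. Moreover: (i) (objective sparsity) $f=\sum_{i=1}^N f_i$, where each $f_i\in\mathbb R[x,\theta_i]$ is a polynomial in $x$ and $\theta_i$ only, with $\deg f_i\le 3$; (ii) (constraint sparsity) let $h=\{h_j\}_{j=1}^{l_h}$ and $g=\{g_k\}_{k=1}^{l_g}$. Then $g\subset\mathbb R[x]$ (the $g_k$ do not depend on $\theta$), and $h$ can be partitioned into $N+1$ disjoint subsets $h=h^\theta\cup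 h^x$, $h^\theta=\bigcup_{i=1}^N h^{\theta_i}$, with $h^{\theta_i}\subset\mathbb R[\theta_i]$ (polynomials in $\theta_i$ only) and $h^x\subset\mathbb R[x]$ (polynomials in $x$ only); (iii) (Archimedeanness) the feasible set $\mathcal P$ of the POP is Archimedean.
   Context: Constants: $N\ge1$ measurements $y_1,\dots,y_N$; $\beta_i>0$ and $\bar c>0$ are given. $\|\cdot\|$ is the Euclidean norm, $\|\cdot\|_F$ the Frobenius norm. The four problems: 1. Single rotation averaging: the model is $R\in\mathrm{SO}(3)$, $y_i=R_i\in \mathrm{SO}(3)$, $r=\|R-R_i\|_F$. 2. Shape alignment: the model is $(R,s)$ with $R\in\mathrm{SO}(3)$, $s\in[0,\bar s]$ ($\bar s>0$ given), $y_i=(B_i,b_i)\in\mathbb R^3\times\mathbb R^2$, $r=\|b_i-s\Pi R B_i\|$ with $\Pi=\begin{bmatrix}1&0&0\\0&1&0\end{bmatrix}$. 3. Point cloud registration: the model is $(R,t)$ with $R\in\mathrm{SO}(3)$, $t\in\mathbb R^3$, $\|t\|\le T$ ($T>0$ given), $y_i=(a_i,b_i)\in\mathbb R^3\times\mathbb R^3$, $r=\|b_i-Ra_i-t\|$. 4. Mesh registration: the model is $(R,t)$ with $R\in\mathrm{SO}(3)$, $t\in\mathbb R^3$, $\|t\|\le T$ ($T>0$ given), $y_i=(a_i,u_i,b_i,v_i)$ with $a_i,b_i\in\mathbb R^3$ and unit vectors $u_i,v_i\in\mathbb R^3$, $r^2=\big((Ru_i)^{\mathsf T}(b_i-Ra_i-t)\big)^2+w_i\|v_i-Ru_i\|^2$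 with $w_i>0$ given. Equivalence: the POP variable $x\in\mathbb R^n$ is a parametrization of the geometric model, possibly after a change of variables: the set of $x$ satisfying $h^x=0$ and $0\le g\le1$ maps onto the set of values of the model that determine the residuals, the set of $\theta$ satisfying $h^\theta=0$ is $\{\pm1\}^N$, and for each such $x$ the minimum over $\theta\in\{\pm1\}^N$ of $f(x,\theta)$ equals the TLS objective at the corresponding model, the minimum being attained with $\theta_i=+1$ if $r^2<\bar c^2\beta_i^2$ (inlier) and $\theta_i=-1$ if $r^2>\bar c^2\beta_i^2$ (outlier). In particular the two problems have the same optimal value $f^\star$. Archimedean: a set $\{p: h_j(p)=0,\ j=1,\dots,l_h;\ g_k(p)\ge0,\ k=1,\dots,l_g\}$ given by polynomial constraints is Archimedean if there exist $M>0$, polynomials $\lambda_j$ and sums-of-squares polynomials $s_k$ such that $M-\|p\|^2=\sum_j\lambda_jh_j+\sum_k s_kg_k$. *)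

theory Defs
  imports "HOL-Analysis.Analysis" "HOL-Library.Poly_Mapping"
begin

section \<open>Real polynomials in finitely many variables\<close>

text \<open>
  Polynomials live in the ring with variables indexed by \<open>nat\<close>; the subring
  $\mathbb{R}[x_i : i \in V]$ is \<open>polys V\<close>. The first argument type of the outer
  \<open>poly_mapping\<close> is the type of monomials (finitely supported exponents).
\<close>

type_synonym real_mpoly = "(nat \<Rightarrow>\<^sub>0 nat) \<Rightarrow>\<^sub>0 real"

definition mConst :: "real \<Rightarrow> real_mpoly" where
  "mConst a = Poly_Mapping.single 0 a"

definition mVar :: "nat \<Rightarrow> real_mpoly" where
  "mVar i = Poly_Mapping.single (Poly_Mapping.single i 1) 1"

definition polys :: "nat set \<Rightarrow> real_mpoly set" where
  "polys V = {q. \<forall>m \<in> Poly_Mapping.keys q. Poly_Mapping.keys m \<subseteq> V}"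

definition monom_degree :: "(nat \<Rightarrow>\<^sub>0 nat) \<Rightarrow> nat" where
  "monom_degree m = (\<Sum>i \<in> Poly_Mapping.keys m. Poly_Mapping.lookup m i)"

text \<open>By convention the zero polynomial has degree 0.\<close>

definition total_degree :: "real_mpoly \<Rightarrow> nat" where
  "total_degree q = Max (insert 0 (monom_degree ` Poly_Mapping.keys q))"

text \<open>
  Points of $\mathbb{R}^d$ are lists of length \<open>d\<close>. The value of \<open>q\<close> at \<open>p\<close> is
  only meaningful if \<open>q \<in> polys {..<length p}\<close>.
\<close>

definition peval :: "real_mpoly \<Rightarrow> real list \<Rightarrow> real" where
  "peval q p = (\<Sum>m \<in> Poly_Mapping.keys q.
     Poly_Mapping.lookup q m * (\<Prod>i \<in> Poly_Mapping.keys m. (p ! i) ^ Poly_Mapping.lookup m i))"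

definition sum_of_squares :: "nat \<Rightarrow> real_mpoly \<Rightarrow> bool" where
  "sum_of_squares d s \<longleftrightarrow>
     (\<exists>qs. set qs \<subseteq> polys {..<d} \<and> s = sum_list (map (\<lambda>q. q\<^sup>2) qs))"

text \<open>
  Archimedeanness of $\{p \in \mathbb{R}^d : h_j(p) = 0,\ g_k(p) \ge 0\}$, as a
  property of the given description. There is no free sum-of-squares summand.
\<close>

definition archimedean_description :: "nat \<Rightarrow> real_mpoly list \<Rightarrow> real_mpoly list \<Rightarrow> bool" where
  "archimedean_description d hs gs \<longleftrightarrow>
     (\<exists>M lam s. M > 0 \<and>
        (\<forall>j<length hs. lam j \<in> polys {..<d}) \<and>
        (\<forall>k<length gs. sum_of_squares d (s k)) \<and>
        mConst M - (\<Sum>i<d. (mVar i)\<^sup>2) =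
          (\<Sum>j<length hs. lam j * hs ! j) + (\<Sum>k<length gs. s k * gs ! k))"


section \<open>Minimization and truncated least squares\<close>

definition is_minimum :: "real \<Rightarrow> ('a \<Rightarrow> real) \<Rightarrow> 'a set \<Rightarrow> bool" where
  "is_minimum v F S \<longleftrightarrow> (\<exists>z\<in>S. F z = v) \<and> (\<forall>z\<in>S. v \<le> F z)"

text \<open>\<open>r m i\<close> is the residual of the model \<open>m\<close> with respect to the \<open>i\<close>-th measurement.\<close>

definition tls_objective ::
    "nat \<Rightarrow> (nat \<Rightarrow> real) \<Rightarrow> real \<Rightarrow> ('m \<Rightarrow> nat \<Rightarrow> real) \<Rightarrow> 'm \<Rightarrow> real" where
  "tls_objective N \<beta> c r m = (\<Sum>i<N. min ((r m i)\<^sup>2 / (\<beta> i)\<^sup>2) (c\<^sup>2))"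


section \<open>Polynomial optimization problems in $p = [x, \theta]$\<close>

definition pop_feasible :: "nat \<Rightarrow> real_mpoly list \<Rightarrow> real_mpoly list \<Rightarrow> real list set" where
  "pop_feasible d hs gs =
     {p. length p = d \<and> (\<forall>h\<in>set hs. peval h p = 0) \<and> (\<forall>g\<in>set gs. 0 \<le> peval g p \<and> peval g p \<le> 1)}"

definition sign_vectors :: "nat \<Rightarrow> real list set" where
  "sign_vectors N = {\<theta>. length \<theta> = N \<and> set \<theta> \<subseteq> {-1, 1}}"

text \<open>
  Variables \<open>0, \<dots>, n - 1\<close> are the coordinates of \<open>x\<close>, variable \<open>n + i\<close>
  is $\theta_i$ (for \<open>i < N\<close>), and the point $[x, \theta]$ is \<open>x @ \<theta>\<close>.
\<close>

definition objective_sparsity :: "nat \<Rightarrow> nat \<Rightarrow> real_mpoly \<Rightarrow> bool" where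
  "objective_sparsity n N f \<longleftrightarrow>
     (\<exists>F. f = (\<Sum>i<N. F i) \<and>
        (\<forall>i<N. F i \<in> polys ({..<n} \<union> {n + i}) \<and> total_degree (F i) \<le> 3))"

definition constraint_sparsity ::
    "nat \<Rightarrow> nat \<Rightarrow> real_mpoly list \<Rightarrow> real_mpoly list \<Rightarrow> real_mpoly set \<Rightarrow> (nat \<Rightarrow> real_mpoly set) \<Rightarrow> bool" where
  "constraint_sparsity n N hs gs Hx H\<theta> \<longleftrightarrow>
     set gs \<subseteq> polys {..<n} \<and>
     set hs = (\<Union>i<N. H\<theta> i) \<union> Hx \<and>
     Hx \<subseteq> polys {..<n} \<and>
     (\<forall>i<N. H\<theta> i \<subseteq> polys {n + i}) \<and>
     (\<forall>i<N. H\<theta> i \<inter> Hx = {}) \<and>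
     (\<forall>i<N. \<forall>j<N. i \<noteq> j \<longrightarrow> H\<theta> i \<inter> H\<theta> j = {})"

definition x_domain :: "nat \<Rightarrow> real_mpoly set \<Rightarrow> real_mpoly list \<Rightarrow> real list set" where
  "x_domain n Hx gs =
     {x. length x = n \<and> (\<forall>h\<in>Hx. peval h x = 0) \<and> (\<forall>g\<in>set gs. 0 \<le> peval g x \<and> peval g x \<le> 1)}"

text \<open>
  \<open>X\<close> is the set of models and \<open>val m\<close> is the part of the model \<open>m\<close> that determines
  the residuals. The map \<open>\<phi>\<close> sends a point \<open>x\<close> to the value it parametrizes. The last
  equivalence says that the minimizing sign vectors are exactly those that label inliers
  with \<open>1\<close> and outliers with \<open>-1\<close> (ties are free).
\<close>

definition tls_equivalent ::
    "'m set \<Rightarrow> ('m \<Rightarrow> 'v) \<Rightarrow> ('m \<Rightarrow> nat \<Rightarrow> real) \<Rightarrow> (nat \<Rightarrow> real) \<Rightarrow> real \<Rightarrow>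
     nat \<Rightarrow> nat \<Rightarrow> real_mpoly \<Rightarrow> real_mpoly list \<Rightarrow> real_mpoly list \<Rightarrow>
     real_mpoly set \<Rightarrow> (nat \<Rightarrow> real_mpoly set) \<Rightarrow> bool" where
  "tls_equivalent X val r \<beta> c n N f hs gs Hx H\<theta> \<longleftrightarrow>
     (\<exists>fstar. is_minimum fstar (tls_objective N \<beta> c r) X \<and>
              is_minimum fstar (peval f) (pop_feasible (n + N) hs gs)) \<and>
     (\<forall>x \<theta>. length x = n \<and> length \<theta> = N \<longrightarrow>
        ((\<forall>i<N. \<forall>h\<in>H\<theta> i. peval h (x @ \<theta>) = 0) \<longleftrightarrow> \<theta> \<in> sign_vectors N)) \<and>
     (\<exists>\<phi>. \<phi> ` x_domain n Hx gs = val ` X \<and>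
        (\<forall>x \<in> x_domain n Hx gs. \<forall>m \<in> X. val m = \<phi> x \<longrightarrow>
           is_minimum (tls_objective N \<beta> c r m) (\<lambda>\<theta>. peval f (x @ \<theta>)) (sign_vectors N) \<and>
           (\<forall>\<theta> \<in> sign_vectors N.
              peval f (x @ \<theta>) = tls_objective N \<beta> c r m \<longleftrightarrow>
              (\<forall>i<N. ((r m i)\<^sup>2 < c\<^sup>2 * (\<beta> i)\<^sup>2 \<longrightarrow> \<theta> ! i = 1) \<and>
                     ((r m i)\<^sup>2 > c\<^sup>2 * (\<beta> i)\<^sup>2 \<longrightarrow> \<theta> ! i = -1)))))"

text \<open>The constraints $0 \le g_k \le 1$ enter Archimedeanness as $g_k \ge 0$ and $1 - g_k \ge 0$.\<close>

definition has_sparse_pop ::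
    "'m set \<Rightarrow> ('m \<Rightarrow> 'v) \<Rightarrow> ('m \<Rightarrow> nat \<Rightarrow> real) \<Rightarrow> nat \<Rightarrow> (nat \<Rightarrow> real) \<Rightarrow> real \<Rightarrow> bool" where
  "has_sparse_pop X val r N \<beta> c \<longleftrightarrow>
     (\<exists>n f hs gs Hx H\<theta>.
        f \<in> polys {..<n + N} \<and> total_degree f \<le> 3 \<and>
        (\<forall>h\<in>set hs. h \<in> polys {..<n + N} \<and> total_degree h = 2) \<and>
        (\<forall>g\<in>set gs. g \<in> polys {..<n + N} \<and> total_degree g = 2) \<and>
        tls_equivalent X val r \<beta> c n N f hs gs Hx H\<theta> \<and>
        objective_sparsity n N f \<and>
        constraint_sparsity n N hs gs Hx H\<theta> \<and>
        archimedean_description (n + N) hs (gs @ map (\<lambda>g. 1 - g) gs))"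


section \<open>The four estimation problems\<close>

definition SO3 :: "(real^3^3) set" where
  "SO3 = {R. rotation_matrix R}"

text \<open>
  The instance \<open>norm\<close> on \<open>real^3^3\<close> is the Euclidean norm of the vector of row norms,
  i.e. the Frobenius norm.
\<close>

definition rotation_residual :: "(nat \<Rightarrow> real^3^3) \<Rightarrow> real^3^3 \<Rightarrow> nat \<Rightarrow> real" where
  "rotation_residual y R i = norm (R - y i)"

definition proj_matrix :: "real^3^2" where
  "proj_matrix = vector [vector [1, 0, 0], vector [0, 1, 0]]"

definition shape_models :: "real \<Rightarrow> ((real^3^3) \<times> real) set" where
  "shape_models sbar = SO3 \<times> {0..sbar}"

fun shape_residual :: "(nat \<Rightarrow> (real^3) \<times> (real^2)) \<Rightarrow> (real^3^3) \<times> real \<Rightarrow> nat \<Rightarrow> real" where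
  "shape_residual y (R, s) i =
     (case y i of (B, b) \<Rightarrow> norm (b - s *\<^sub>R (proj_matrix *v (R *v B))))"

text \<open>Shape alignment residuals depend on $(R, s)$ only through $s \Pi R$.\<close>

fun shape_value :: "(real^3^3) \<times> real \<Rightarrow> real^3^2" where
  "shape_value (R, s) = s *\<^sub>R (proj_matrix ** R)"

definition rigid_models :: "real \<Rightarrow> ((real^3^3) \<times> (real^3)) set" where
  "rigid_models T = SO3 \<times> {t. norm t \<le> T}"

fun point_cloud_residual ::
    "(nat \<Rightarrow> (real^3) \<times> (real^3)) \<Rightarrow> (real^3^3) \<times> (real^3) \<Rightarrow> nat \<Rightarrow> real" where
  "point_cloud_residual y (R, t) i = (case y i of (a, b) \<Rightarrow> norm (b - R *v a - t))"

fun mesh_residual ::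
    "(nat \<Rightarrow> real) \<Rightarrow> (nat \<Rightarrow> (real^3) \<times> (real^3) \<times> (real^3) \<times> (real^3)) \<Rightarrow>
     (real^3^3) \<times> (real^3) \<Rightarrow> nat \<Rightarrow> real" where
  "mesh_residual w y (R, t) i = (case y i of (a, u, b, v) \<Rightarrow>
     sqrt (((R *v u) \<bullet> (b - R *v a - t))\<^sup>2 + w i * (norm (v - R *v u))\<^sup>2))"

end

theory Submission
  imports Defs
begin

text \<open>
  Since \<open>min a b\<close> is the minimum of \<open>(1 + \<theta>) / 2 * a + (1 - \<theta>) / 2 * b\<close> over signs \<open>\<theta>\<close>, a sum of
  truncated squares becomes a cubic in \<open>(x, \<theta>)\<close> as soon as each squared residual is a quadratic
  polynomial in the parameters \<open>x\<close>. The model set is compact, so the optimal value is attained. For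
  rotations the unit-length, orthogonality and cross-product equations on the rows are
  quadratic and define $\mathrm{SO}(3)$. The residuals are then quadratic for a suitable choice of
  \<open>x\<close>: the pair \<open>(R, t)\<close> in general, the pair \<open>(R, R\<^sup>T t)\<close> for meshes, and the matrix \<open>s \<Pi> R\<close> for
  shapes. The Archimedean certificate uses only constant multipliers: the unit-length constraints on
  rows and signs, and the bound on the translation or scale, add up to a constant minus the
  squared norm of the whole variable.
\<close>

section \<open>Evaluation and bounded-degree polynomials\<close>

definition meval :: "(nat \<Rightarrow>\<^sub>0 nat) \<Rightarrow> real list \<Rightarrow> real" where
  "meval m p = (\<Prod>i \<in> Poly_Mapping.keys m. (p ! i) ^ Poly_Mapping.lookup m i)"

text \<open>Indices outside the support have exponent 0 and contribute a factor 1, so several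
  monomials can be evaluated over one common index set.\<close>

lemma meval_superset:
  assumes "finite S" "Poly_Mapping.keys m \<subseteq> S"
  shows "meval m p = (\<Prod>i\<in>S. (p ! i) ^ Poly_Mapping.lookup m i)"
  unfolding meval_def using assms by (intro prod.mono_neutral_left) (auto simp: in_keys_iff)

text \<open>Natural exponents cannot cancel, which gives equality where general coefficients would
  give only an inclusion.\<close>

lemma keys_add_nat:
  "Poly_Mapping.keys (a + b :: nat \<Rightarrow>\<^sub>0 nat) = Poly_Mapping.keys a \<union> Poly_Mapping.keys b"
  by (auto simp: in_keys_iff lookup_add)

lemma meval_add: "meval (a + b) p = meval a p * meval b p"
proof -
  let ?S = "Poly_Mapping.keys a \<union> Poly_Mapping.keys b"
  have "meval (a + b) p = (\<Prod>i\<in>?S. (p ! i) ^ Poly_Mapping.lookup (a + b) i)"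
    by (intro meval_superset) (auto simp: keys_add_nat)
  also have "\<dots> = (\<Prod>i\<in>?S. (p ! i) ^ Poly_Mapping.lookup a i) * (\<Prod>i\<in>?S. (p ! i) ^ Poly_Mapping.lookup b i)"
    by (simp add: lookup_add power_add prod.distrib)
  also have "\<dots> = meval a p * meval b p"
    by (simp add: meval_superset[of ?S])
  finally show ?thesis .
qed

lemma meval_0 [simp]: "meval 0 p = 1"
  by (simp add: meval_def)

lemma peval_superset:
  assumes "finite S" "Poly_Mapping.keys q \<subseteq> S"
  shows "peval q p = (\<Sum>m\<in>S. Poly_Mapping.lookup q m * meval m p)"
  unfolding peval_def meval_def[symmetric]
  using assms by (intro sum.mono_neutral_left) (auto simp: in_keys_iff)

lemma peval_add [simp]: "peval (q + q') p = peval q p + peval q' p"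
proof -
  let ?S = "Poly_Mapping.keys q \<union> Poly_Mapping.keys q'"
  have "peval (q + q') p = (\<Sum>m\<in>?S. Poly_Mapping.lookup (q + q') m * meval m p)"
    by (intro peval_superset Poly_Mapping.keys_add) auto
  also have "\<dots> = peval q p + peval q' p"
    by (simp add: lookup_add distrib_right sum.distrib peval_superset[of ?S])
  finally show ?thesis .
qed

lemma peval_zero [simp]: "peval 0 p = 0"
  by (simp add: peval_def)

lemma peval_uminus [simp]: "peval (- q) p = - peval q p"
  using peval_add[of q "- q" p] by simp

lemma peval_diff [simp]: "peval (q - q') p = peval q p - peval q' p"
  using peval_add[of q "- q'" p] by simp

lemma peval_sum [simp]: "peval (\<Sum>i\<in>A. q i) p = (\<Sum>i\<in>A. peval (q i) p)"
  by (induction A rule: infinite_finite_induct) auto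

lemma peval_single: "peval (Poly_Mapping.single m a) p = a * meval m p"
  by (subst peval_superset[of "{m}"]) auto

lemma sum_single_lookup:
  "(\<Sum>m\<in>Poly_Mapping.keys q. Poly_Mapping.single m (Poly_Mapping.lookup q m)) = q"
  by (intro poly_mapping_eqI)
     (auto simp: lookup_sum lookup_single when_def in_keys_iff)

text \<open>Expanding both factors into single monomials reduces the claim to multiplicativity on
  monomials, \<open>meval_add\<close>.\<close>

lemma peval_mult [simp]: "peval (q * q') p = peval q p * peval q' p"
proof -
  let ?t = "\<lambda>q m. Poly_Mapping.single m (Poly_Mapping.lookup q m) :: real_mpoly"
  have "peval (q * q') p = peval ((\<Sum>m\<in>Poly_Mapping.keys q. ?t q m) * (\<Sum>m\<in>Poly_Mapping.keys q'. ?t q' m)) p"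
    by (simp add: sum_single_lookup)
  also have "\<dots> = (\<Sum>m\<in>Poly_Mapping.keys q. peval (?t q m) p) * (\<Sum>m\<in>Poly_Mapping.keys q'. peval (?t q' m) p)"
    by (simp add: sum_product mult_single peval_single meval_add mult_ac)
  also have "\<dots> = peval q p * peval q' p"
    by (simp add: sum_single_lookup flip: peval_sum)
  finally show ?thesis .
qed

lemma peval_const [simp]: "peval (mConst a) p = a"
  by (simp add: mConst_def peval_single)

lemma mConst_1: "mConst 1 = 1"
  by (simp add: mConst_def)

lemma peval_one [simp]: "peval 1 p = 1"
  using peval_const[of 1] by (simp add: mConst_1)

lemma peval_power [simp]: "peval (q ^ k) p = peval q p ^ k"
  by (induction k) auto

lemma peval_var [simp]: "peval (mVar i) p = p ! i"
  by (simp add: mVar_def peval_single meval_def)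

lemma mConst_add: "mConst (a + b) = mConst a + mConst b"
  by (simp add: mConst_def single_add)

lemma mConst_mult: "mConst (a * b) = mConst a * mConst b"
  by (simp add: mConst_def mult_single)

lemma mConst_minus: "mConst (- a) = - mConst a"
  by (simp add: mConst_def single_uminus)

lemma mConst_0 [simp]: "mConst 0 = 0"
  by (simp add: mConst_def)

lemma mConst_numeral: "mConst (numeral k) = numeral k"
  by (simp add: mConst_def)

lemma mConst_of_nat: "mConst (of_nat k) = of_nat k"
  by (simp add: mConst_def)

text \<open>Variables and degree are tracked together, so that one set of closure rules settles
  both. The degree is only bounded above, since leading terms may cancel in sums.\<close>

definition bpolys :: "nat set \<Rightarrow> nat \<Rightarrow> real_mpoly set" where
  "bpolys V d = {q \<in> polys V. total_degree q \<le> d}"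

lemma total_degree_le_iff:
  "total_degree q \<le> d \<longleftrightarrow> (\<forall>m\<in>Poly_Mapping.keys q. monom_degree m \<le> d)"
  by (simp add: total_degree_def)

lemma bpolys_iff:
  "q \<in> bpolys V d \<longleftrightarrow> (\<forall>m\<in>Poly_Mapping.keys q. Poly_Mapping.keys m \<subseteq> V \<and> monom_degree m \<le> d)"
  by (auto simp: bpolys_def polys_def total_degree_le_iff)

lemma bpolys_mono: "q \<in> bpolys V d \<Longrightarrow> V \<subseteq> W \<Longrightarrow> d \<le> e \<Longrightarrow> q \<in> bpolys W e"
  by (force simp: bpolys_iff)

lemma monom_degree_superset:
  assumes "finite S" "Poly_Mapping.keys m \<subseteq> S"
  shows "monom_degree m = (\<Sum>i\<in>S. Poly_Mapping.lookup m i)"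
  unfolding monom_degree_def using assms by (intro sum.mono_neutral_left) (auto simp: in_keys_iff)

lemma monom_degree_add: "monom_degree (a + b) = monom_degree a + monom_degree b"
  by (simp add: monom_degree_superset[of "Poly_Mapping.keys a \<union> Poly_Mapping.keys b"]
      keys_add_nat lookup_add sum.distrib)

lemma bpolys_const [intro!]: "mConst a \<in> bpolys V d"
  by (auto simp: bpolys_iff mConst_def monom_degree_def split: if_splits)

lemma bpolys_0 [intro!]: "0 \<in> bpolys V d" and bpolys_1 [intro!]: "1 \<in> bpolys V d"
  using bpolys_const[of 0] bpolys_const[of 1] by (simp_all add: mConst_1)

lemma bpolys_var [intro]: "i \<in> V \<Longrightarrow> 1 \<le> d \<Longrightarrow> mVar i \<in> bpolys V d"
  by (auto simp: bpolys_iff mVar_def monom_degree_def)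

lemma bpolys_add [intro]: "q \<in> bpolys V d \<Longrightarrow> q' \<in> bpolys V d \<Longrightarrow> q + q' \<in> bpolys V d"
  using Poly_Mapping.keys_add[of q q'] by (auto simp: bpolys_iff)

lemma bpolys_uminus [intro]: "q \<in> bpolys V d \<Longrightarrow> - q \<in> bpolys V d"
  by (simp add: bpolys_iff)

lemma bpolys_diff [intro]: "q \<in> bpolys V d \<Longrightarrow> q' \<in> bpolys V d \<Longrightarrow> q - q' \<in> bpolys V d"
  using bpolys_add[of q V d "- q'"] by auto

lemma bpolys_sum [intro]: "(\<And>i. i \<in> A \<Longrightarrow> q i \<in> bpolys V d) \<Longrightarrow> (\<Sum>i\<in>A. q i) \<in> bpolys V d"
  by (induction A rule: infinite_finite_induct) auto

lemma bpolys_mult: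
  assumes "q \<in> bpolys V d" "q' \<in> bpolys V e"
  shows "q * q' \<in> bpolys V (d + e)"
  unfolding bpolys_iff
proof
  fix m assume "m \<in> Poly_Mapping.keys (q * q')"
  then obtain a b where "m = a + b" "a \<in> Poly_Mapping.keys q" "b \<in> Poly_Mapping.keys q'"
    using Poly_Mapping.keys_mult[of q q'] by blast
  then show "Poly_Mapping.keys m \<subseteq> V \<and> monom_degree m \<le> d + e"
    using assms by (force simp: bpolys_iff keys_add_nat monom_degree_add)
qed

lemma bpolys_mult_const [intro]: "q \<in> bpolys V d \<Longrightarrow> mConst a * q \<in> bpolys V d"
  using bpolys_mult[of "mConst a" V 0 q d] by auto

lemma bpolys_mult_linear [intro]: "q \<in> bpolys V 1 \<Longrightarrow> q' \<in> bpolys V 1 \<Longrightarrow> q * q' \<in> bpolys V 2"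
  using bpolys_mult[of q V 1 q' 1] by (simp add: numeral_2_eq_2)

lemma bpolys_square_linear [intro]: "q \<in> bpolys V 1 \<Longrightarrow> q\<^sup>2 \<in> bpolys V 2"
  by (auto simp only: power2_eq_square)

lemma bpolysD: assumes "q \<in> bpolys V d" shows "q \<in> polys V" "total_degree q \<le> d"
  using assms by (auto simp: bpolys_def)

section \<open>Dependence on variables and exact degree\<close>

lemma peval_cong:
  assumes "q \<in> polys V" "\<And>i. i \<in> V \<Longrightarrow> p ! i = p' ! i"
  shows "peval q p = peval q p'"
proof -
  have "meval m p = meval m p'" if "m \<in> Poly_Mapping.keys q" for m
  proof -
    have "Poly_Mapping.keys m \<subseteq> V"
      using assms(1) that by (simp add: polys_def)
    then show ?thesis
      unfolding meval_def using assms(2) by (intro prod.cong) auto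
  qed
  then show ?thesis
    by (simp add: peval_superset[of "Poly_Mapping.keys q"])
qed

lemma peval_append: "q \<in> polys {..<length x} \<Longrightarrow> peval q (x @ z) = peval q x"
  by (rule peval_cong) (auto simp: nth_append)

text \<open>A polynomial of degree at most 1 is affine, so its second difference along a line vanishes.\<close>

lemma peval_affine:
  assumes "q \<in> bpolys {..<length p} 1"
  shows "peval q (map ((*) 2) p) - 2 * peval q p + peval q (map (\<lambda>_. 0) p) = 0"
proof -
  have "meval m (map ((*) 2) p) - 2 * meval m p + meval m (map (\<lambda>_. 0) p) = 0"
    if "m \<in> Poly_Mapping.keys q" for m
  proof -
    have V: "Poly_Mapping.keys m \<subseteq> {..<length p}" and d: "monom_degree m \<le> 1"
      using assms that by (auto simp: bpolys_iff)
    show ?thesis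
    \<comment> \<open>The constant monomial gives 1 - 2 + 1 = 0. Any other monomial of degree at
      most 1 is a single variable p_i, which gives 2 p_i - 2 p_i + 0 = 0.\<close>
    proof (cases "m = 0")
      case False
      then obtain i where i: "i \<in> Poly_Mapping.keys m"
        by (metis poly_mapping_eqI in_keys_iff lookup_zero)
      have "sum (Poly_Mapping.lookup m) S \<le> 1" if "S \<subseteq> Poly_Mapping.keys m" for S
        using sum_mono2[OF finite_keys that, of "Poly_Mapping.lookup m"] d
        unfolding monom_degree_def by linarith
      from this[of "{i}"] this[of "{i, j}" for j]
      have le: "Poly_Mapping.lookup m i \<le> 1"
        "\<And>j. j \<noteq> i \<Longrightarrow> j \<in> Poly_Mapping.keys m \<Longrightarrow> Poly_Mapping.lookup m i + Poly_Mapping.lookup m j \<le> 1"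
        using i by force+
      have "Poly_Mapping.keys m = {i}" "Poly_Mapping.lookup m i = 1"
        using i le by (fastforce simp: in_keys_iff)+
      then show ?thesis using V by (simp add: meval_def)
    qed auto
  qed
  then have "(\<Sum>m\<in>Poly_Mapping.keys q. Poly_Mapping.lookup q m *
     (meval m (map ((*) 2) p) - 2 * meval m p + meval m (map (\<lambda>_. 0) p))) = 0"
    by simp
  then show ?thesis
    by (simp add: peval_superset[of "Poly_Mapping.keys q"] algebra_simps sum.distrib sum_subtractf sum_distrib_left)
qed

text \<open>A single point with nonzero second difference along 0, p, 2p excludes degree at most 1.
  Exact degrees of concrete polynomials thus follow from a numerical evaluation, without computing
  their supports.\<close>

lemma total_degree_eq_2I:
  assumes "q \<in> bpolys {..<length p} 2"
    and "peval q (map ((*) 2) p) - 2 * peval q p + peval q (map (\<lambda>_. 0) p) \<noteq> 0"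
  shows "total_degree q = 2"
proof -
  have "\<not> total_degree q \<le> 1"
    using peval_affine[of q p] assms by (auto simp: bpolys_def)
  then show ?thesis using bpolysD(2)[OF assms(1)] by simp
qed


section \<open>Truncated least squares with quadratic residuals\<close>

definition \<theta>_constraint :: "nat \<Rightarrow> real_mpoly" where
  "\<theta>_constraint k = (mVar k)\<^sup>2 - 1"

lemma polys_mono: "q \<in> polys V \<Longrightarrow> V \<subseteq> W \<Longrightarrow> q \<in> polys W"
  by (force simp: polys_def)

lemma polys_mConst [intro!]: "mConst a \<in> polys V"
  using bpolys_const bpolysD(1) by blast

lemma \<theta>_constraint_bpolys: "\<theta>_constraint k \<in> bpolys {k} 2"
  unfolding \<theta>_constraint_def by auto

text \<open>Two points that differ only in coordinate k give the values -1 and 0. This separates the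
  sign constraints from each other and from the constraints on x.\<close>

lemma \<theta>_constraint_notin:
  assumes "k \<notin> V"
  shows "\<theta>_constraint k \<notin> polys V"
proof
  assume "\<theta>_constraint k \<in> polys V"
  \<comment> \<open>Beyond index k both lists yield the same unspecified \<open>nth\<close> value,
    so they agree on all of V.\<close>
  then have "peval (\<theta>_constraint k) (replicate k 0 @ [0]) = peval (\<theta>_constraint k) (replicate k 0 @ [1])"
    using assms by (intro peval_cong[of _ V]) (auto simp: nth_append nth_Cons')
  then show False
    by (simp add: \<theta>_constraint_def nth_append)
qed

lemma total_degree_\<theta>_constraint: "total_degree (\<theta>_constraint k) = 2"
proof (rule total_degree_eq_2I[of _ "replicate (Suc k) 1"])
  show "\<theta>_constraint k \<in> bpolys {..<length (replicate (Suc k) (1::real))} 2"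
    using \<theta>_constraint_bpolys by (rule bpolys_mono) auto
qed (simp add: \<theta>_constraint_def del: replicate_Suc)

lemma sum_of_squares_mConst:
  assumes "a \<ge> 0"
  shows "sum_of_squares d (mConst a)"
  unfolding sum_of_squares_def
  using assms by (intro exI[of _ "[mConst (sqrt a)]"]) (auto simp: power2_eq_square simp flip: mConst_mult)

lemma sum_of_squares_mono:
  assumes "sum_of_squares d s" "d \<le> e"
  shows "sum_of_squares e s"
proof -
  have "polys {..<d} \<subseteq> polys {..<e}"
    using assms(2) by (auto intro: polys_mono)
  then show ?thesis
    using assms(1) unfolding sum_of_squares_def by blast
qed

lemma sum_lessThan_add:
  fixes f :: "nat \<Rightarrow> 'a::comm_monoid_add"
  shows "(\<Sum>i<m + n. f i) = (\<Sum>i<m. f i) + (\<Sum>i<n. f (m + i))"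
  by (induction n) (simp_all add: add.assoc)

lemma sum_append_nth:
  fixes lam :: "nat \<Rightarrow> 'a::semiring_0"
  shows "(\<Sum>j<length (xs @ ys). lam j * (xs @ ys) ! j) =
    (\<Sum>j<length xs. lam j * xs ! j) + (\<Sum>j<length ys. lam (length xs + j) * ys ! j)"
  by (simp add: sum_lessThan_add nth_append)

text \<open>Multiplier -1 on each sign constraint adds N minus the squared norm of \<theta>, which
  raises the constant from M to M + N. The appended inequalities \<open>gs'\<close> receive
  multiplier 0; they will be the upper bounds 1 - g.\<close>

lemma archimedean_description_append:
  assumes "archimedean_description n hx gs"
  shows "archimedean_description (n + N) (hx @ map (\<lambda>i. \<theta>_constraint (n + i)) [0..<N]) (gs @ gs')"
proof -
  obtain M lam s where M: "M > 0"
    and lam: "\<And>j. j < length hx \<Longrightarrow> lam j \<in> polys {..<n}"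
    and s: "\<And>k. k < length gs \<Longrightarrow> sum_of_squares n (s k)"
    and eq: "mConst M - (\<Sum>i<n. (mVar i)\<^sup>2) =
          (\<Sum>j<length hx. lam j * hx ! j) + (\<Sum>k<length gs. s k * gs ! k)"
    using assms unfolding archimedean_description_def by blast
  define lam' where "lam' = (\<lambda>j. if j < length hx then lam j else - 1)"
  define s' where "s' = (\<lambda>k. if k < length gs then s k else mConst 0)"
  let ?h\<theta> = "map (\<lambda>i. \<theta>_constraint (n + i)) [0..<N]"
  have "(\<Sum>j<length (hx @ ?h\<theta>). lam' j * (hx @ ?h\<theta>) ! j) =
      (\<Sum>j<length hx. lam j * hx ! j) + (of_nat N - (\<Sum>i<N. (mVar (n + i))\<^sup>2))"
    unfolding sum_append_nth by (simp add: lam'_def \<theta>_constraint_def sum_subtractf)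
  moreover have "(\<Sum>k<length (gs @ gs'). s' k * (gs @ gs') ! k) = (\<Sum>k<length gs. s k * gs ! k)"
    unfolding sum_append_nth by (simp add: s'_def)
  moreover have "(\<Sum>i<n + N. (mVar i)\<^sup>2) = (\<Sum>i<n. (mVar i)\<^sup>2) + (\<Sum>i<N. (mVar (n + i))\<^sup>2)"
    by (rule sum_lessThan_add)
  ultimately have "mConst (M + of_nat N) - (\<Sum>i<n + N. (mVar i)\<^sup>2) =
     (\<Sum>j<length (hx @ ?h\<theta>). lam' j * (hx @ ?h\<theta>) ! j) + (\<Sum>k<length (gs @ gs'). s' k * (gs @ gs') ! k)"
    using eq by (simp add: mConst_add mConst_of_nat algebra_simps)
  moreover have "lam' j \<in> polys {..<n + N}" for j
  proof (cases "j < length hx")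
    case True
    then show ?thesis
      using polys_mono[OF lam] by (simp add: lam'_def)
  next
    case False
    then show ?thesis
      using polys_mConst[of "-1"] by (simp add: lam'_def mConst_minus mConst_1)
  qed
  moreover have "sum_of_squares (n + N) (s' k)" for k
    using s[of k] sum_of_squares_mConst[of 0 "n + N"] by (auto simp: s'_def intro: sum_of_squares_mono)
  moreover have "M + of_nat N > 0"
    using M by simp
  ultimately show ?thesis
    unfolding archimedean_description_def by blast
qed

section \<open>Attained minima and sign gating\<close>

lemma tls_minimum_exists:
  fixes r :: "'m::topological_space \<Rightarrow> nat \<Rightarrow> real"
  assumes "compact X" "X \<noteq> {}" "\<And>i. i < N \<Longrightarrow> continuous_on X (\<lambda>m. r m i)"
  shows "\<exists>v. is_minimum v (tls_objective N \<beta> c r) X"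
proof -
  \<comment> \<open>Multiplication by a constant inverse replaces the division, so continuity raises
    no question about zeros of the denominator.\<close>
  have "continuous_on X (\<lambda>m. \<Sum>i<N. min ((r m i)\<^sup>2 * inverse ((\<beta> i)\<^sup>2)) (c\<^sup>2))"
    using assms(3) by (intro continuous_on_sum continuous_on_min continuous_intros) auto
  then have "continuous_on X (tls_objective N \<beta> c r)"
    by (simp add: tls_objective_def[abs_def] divide_inverse)
  from continuous_attains_inf[OF assms(1,2) this] show ?thesis
    unfolding is_minimum_def by blast
qed

text \<open>At sign 1 only q / b^2 survives, at sign -1 only the cap c^2. The product of the sign
  with a quadratic q is the sole source of degree 3.\<close>

definition gated_term :: "nat \<Rightarrow> real \<Rightarrow> real \<Rightarrow> real_mpoly \<Rightarrow> real_mpoly" where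
  "gated_term k b c q =
     mConst (1 / (2 * b\<^sup>2)) * ((1 + mVar k) * q) + mConst (c\<^sup>2 / 2) * (1 - mVar k)"

lemma gated_term_bpolys:
  assumes "q \<in> bpolys {..<n} 2"
  shows "gated_term (n + i) b c q \<in> bpolys ({..<n} \<union> {n + i}) 3"
proof -
  have "q \<in> bpolys ({..<n} \<union> {n + i}) 2"
    using assms by (rule bpolys_mono) auto
  moreover have "1 + mVar (n + i) \<in> bpolys ({..<n} \<union> {n + i}) 1"
    by (intro bpolys_add bpolys_var) auto
  ultimately have "(1 + mVar (n + i)) * q \<in> bpolys ({..<n} \<union> {n + i}) 3"
    using bpolys_mult by fastforce
  then show ?thesis
    unfolding gated_term_def by (intro bpolys_add bpolys_mult_const bpolys_diff) auto
qed

text \<open>For a sign t the mixture is one of the two arguments of the minimum. It is therefore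
  never smaller, and equal exactly when t selects a smallest argument; at a tie both signs
  do.\<close>

lemma sign_mixture:
  fixes t \<rho> c b :: real
  assumes "t \<in> {-1, 1}" "b > 0"
  shows "min (\<rho> / b\<^sup>2) (c\<^sup>2) \<le> 1 / (2 * b\<^sup>2) * ((1 + t) * \<rho>) + c\<^sup>2 / 2 * (1 - t)"
    and "1 / (2 * b\<^sup>2) * ((1 + t) * \<rho>) + c\<^sup>2 / 2 * (1 - t) = min (\<rho> / b\<^sup>2) (c\<^sup>2) \<longleftrightarrow>
      (\<rho> < c\<^sup>2 * b\<^sup>2 \<longrightarrow> t = 1) \<and> (\<rho> > c\<^sup>2 * b\<^sup>2 \<longrightarrow> t = -1)"
  using assms by (auto simp: min_def field_simps)

text \<open>Nonnegative gaps sum to zero only if each vanishes. This turns optimality of \<theta>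
  into one condition per measurement.\<close>

lemma sum_eq_iff_le:
  fixes f g :: "'a \<Rightarrow> real"
  assumes "finite A" "\<And>i. i \<in> A \<Longrightarrow> g i \<le> f i"
  shows "sum f A = sum g A \<longleftrightarrow> (\<forall>i\<in>A. f i = g i)"
proof -
  have "sum f A = sum g A \<longleftrightarrow> (\<Sum>i\<in>A. f i - g i) = 0"
    by (simp add: sum_subtractf)
  also have "\<dots> \<longleftrightarrow> (\<forall>i\<in>A. f i - g i = 0)"
    using assms by (intro sum_nonneg_eq_0_iff) auto
  finally show ?thesis by simp
qed

text \<open>Everything that involves \<theta> is built here once. Each problem then supplies a
  quadratic description of x, its certificate, and quadratics q that agree with the squared
  residuals on the domain of x, though not necessarily elsewhere.\<close>

lemma has_sparse_popI:
  fixes r :: "'m::topological_space \<Rightarrow> nat \<Rightarrow> real"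
  assumes \<beta>: "\<And>i. i < N \<Longrightarrow> \<beta> i > 0"
    and q: "\<And>i. i < N \<Longrightarrow> q i \<in> bpolys {..<n} 2"
    and hx: "\<And>h. h \<in> set hx \<Longrightarrow> h \<in> polys {..<n} \<and> total_degree h = 2"
    and gs: "\<And>g. g \<in> set gs \<Longrightarrow> g \<in> polys {..<n} \<and> total_degree g = 2"
    and \<phi>: "\<phi> ` x_domain n (set hx) gs = val ` X"
    and q_eq: "\<And>i x m. i < N \<Longrightarrow> x \<in> x_domain n (set hx) gs \<Longrightarrow> m \<in> X \<Longrightarrow> val m = \<phi> x \<Longrightarrow>
      peval (q i) x = (r m i)\<^sup>2"
    and X: "compact X" "X \<noteq> {}" "\<And>i. i < N \<Longrightarrow> continuous_on X (\<lambda>m. r m i)"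
    and arch: "archimedean_description n hx gs"
  shows "has_sparse_pop X val r N \<beta> c"
proof -
  define F where "F i = gated_term (n + i) (\<beta> i) c (q i)" for i
  define f where "f = (\<Sum>i<N. F i)"
  define hs where "hs = hx @ map (\<lambda>i. \<theta>_constraint (n + i)) [0..<N]"
  define H where "H i = {\<theta>_constraint (n + i)}" for i
  let ?D = "x_domain n (set hx) gs"
  have F: "F i \<in> bpolys ({..<n} \<union> {n + i}) 3" if "i < N" for i
    unfolding F_def using q[OF that] by (rule gated_term_bpolys)
  have f: "f \<in> bpolys {..<n + N} 3"
    unfolding f_def by (intro bpolys_sum bpolys_mono[OF F]) auto
  have peval_f: "peval f (x @ \<theta>) =
      (\<Sum>i<N. 1 / (2 * (\<beta> i)\<^sup>2) * ((1 + \<theta> ! i) * peval (q i) x) + c\<^sup>2 / 2 * (1 - \<theta> ! i))"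
    if "length x = n" for x \<theta>
    unfolding f_def peval_sum
  proof (intro sum.cong refl)
    fix i assume "i \<in> {..<N}"
    then have "peval (q i) (x @ \<theta>) = peval (q i) x"
      using bpolysD(1)[OF q[of i]] that by (intro peval_append) auto
    then show "peval (F i) (x @ \<theta>) =
        1 / (2 * (\<beta> i)\<^sup>2) * ((1 + \<theta> ! i) * peval (q i) x) + c\<^sup>2 / 2 * (1 - \<theta> ! i)"
      using that by (simp add: F_def gated_term_def nth_append)
  qed
  have signs: "(\<forall>i<N. \<forall>h\<in>H i. peval h (x @ \<theta>) = 0) \<longleftrightarrow> \<theta> \<in> sign_vectors N"
    if "length x = n" "length \<theta> = N" for x \<theta>
    using that by (auto simp: H_def \<theta>_constraint_def sign_vectors_def nth_append power2_eq_1_iff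
        subset_iff in_set_conv_nth)
  have lower: "tls_objective N \<beta> c r m \<le> peval f (x @ \<theta>)"
    and exact: "peval f (x @ \<theta>) = tls_objective N \<beta> c r m \<longleftrightarrow>
      (\<forall>i<N. ((r m i)\<^sup>2 < c\<^sup>2 * (\<beta> i)\<^sup>2 \<longrightarrow> \<theta> ! i = 1) \<and>
        ((r m i)\<^sup>2 > c\<^sup>2 * (\<beta> i)\<^sup>2 \<longrightarrow> \<theta> ! i = -1))"
    if "x \<in> ?D" "m \<in> X" "val m = \<phi> x" "\<theta> \<in> sign_vectors N" for x m \<theta>
  proof -
    have \<theta>: "\<theta> ! i \<in> {-1, 1}" if "i < N" for i
      using \<open>\<theta> \<in> sign_vectors N\<close> that unfolding sign_vectors_def by (auto dest: nth_mem)
    have pf: "peval f (x @ \<theta>) =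
      (\<Sum>i<N. 1 / (2 * (\<beta> i)\<^sup>2) * ((1 + \<theta> ! i) * (r m i)\<^sup>2) + c\<^sup>2 / 2 * (1 - \<theta> ! i))"
      using that q_eq by (subst peval_f) (auto simp: x_domain_def intro!: sum.cong)
    show "tls_objective N \<beta> c r m \<le> peval f (x @ \<theta>)"
      unfolding pf tls_objective_def using sign_mixture(1)[OF \<theta> \<beta>] by (intro sum_mono) auto
    show "peval f (x @ \<theta>) = tls_objective N \<beta> c r m \<longleftrightarrow>
      (\<forall>i<N. ((r m i)\<^sup>2 < c\<^sup>2 * (\<beta> i)\<^sup>2 \<longrightarrow> \<theta> ! i = 1) \<and>
        ((r m i)\<^sup>2 > c\<^sup>2 * (\<beta> i)\<^sup>2 \<longrightarrow> \<theta> ! i = -1))"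
      unfolding pf tls_objective_def
      using sign_mixture[OF \<theta> \<beta>] by (subst sum_eq_iff_le) auto
  qed
  have attained: "\<exists>\<theta>\<in>sign_vectors N. peval f (x @ \<theta>) = tls_objective N \<beta> c r m"
    if "x \<in> ?D" "m \<in> X" "val m = \<phi> x" for x m
  proof -
    \<comment> \<open>Ties are labelled -1; \<open>exact\<close> admits either sign there.\<close>
    let ?\<theta> = "map (\<lambda>i. if (r m i)\<^sup>2 < c\<^sup>2 * (\<beta> i)\<^sup>2 then 1 else -1) [0..<N]"
    have "?\<theta> \<in> sign_vectors N"
      by (auto simp: sign_vectors_def)
    moreover from this have "peval f (x @ ?\<theta>) = tls_objective N \<beta> c r m"
      by (subst exact[OF that]) auto
    ultimately show ?thesis by blast
  qed
  \<comment> \<open>Each constraint involves either x alone or one sign alone, so the feasible set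
    is a product.\<close>
  have feasible: "x @ \<theta> \<in> pop_feasible (n + N) hs gs \<longleftrightarrow> x \<in> ?D \<and> \<theta> \<in> sign_vectors N"
    if "length x = n" "length \<theta> = N" for x \<theta>
  proof -
    have "(\<forall>h\<in>set hs. peval h (x @ \<theta>) = 0) \<longleftrightarrow> (\<forall>h\<in>set hx. peval h x = 0) \<and> \<theta> \<in> sign_vectors N"
    proof -
      have "(\<forall>h\<in>set hx. peval h (x @ \<theta>) = 0) \<longleftrightarrow> (\<forall>h\<in>set hx. peval h x = 0)"
        using hx that by (intro ball_cong refl) (simp add: peval_append)
      moreover have "(\<forall>h\<in>set hs. peval h (x @ \<theta>) = 0) \<longleftrightarrow>
          (\<forall>h\<in>set hx. peval h (x @ \<theta>) = 0) \<and> (\<forall>i<N. \<forall>h\<in>H i. peval h (x @ \<theta>) = 0)"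
        by (auto simp: hs_def H_def)
      ultimately show ?thesis
        using signs that by simp
    qed
    moreover have "peval g (x @ \<theta>) = peval g x" if "g \<in> set gs" for g
      using gs[OF that] \<open>length x = n\<close> by (simp add: peval_append)
    ultimately show ?thesis
      using that by (auto simp: pop_feasible_def x_domain_def)
  qed
  obtain v where v: "is_minimum v (tls_objective N \<beta> c r) X"
    using tls_minimum_exists[of X N r \<beta> c] X by blast
  have "is_minimum v (peval f) (pop_feasible (n + N) hs gs)"
    unfolding is_minimum_def
  proof (intro conjI ballI)
    obtain m where m: "m \<in> X" "tls_objective N \<beta> c r m = v"
      using v by (auto simp: is_minimum_def)
    then obtain x where x: "x \<in> ?D" "val m = \<phi> x"
      using \<phi> by (metis imageE imageI)
    then obtain \<theta> where \<theta>: "\<theta> \<in> sign_vectors N" "peval f (x @ \<theta>) = v"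
      using attained m by blast
    have "x @ \<theta> \<in> pop_feasible (n + N) hs gs"
      using x \<theta> by (subst feasible) (auto simp: x_domain_def sign_vectors_def)
    then show "\<exists>z\<in>pop_feasible (n + N) hs gs. peval f z = v"
      using \<theta> by blast
  next
    fix p assume p: "p \<in> pop_feasible (n + N) hs gs"
    \<comment> \<open>Splitting p reduces the bound to the chain: v is at most the TLS objective of
      a model with value \<phi> x, which is at most f at p.\<close>
    define x \<theta> where "x = take n p" and "\<theta> = drop n p"
    have "p = x @ \<theta>" "length x = n" "length \<theta> = N"
      using p by (auto simp: x_def \<theta>_def pop_feasible_def)
    then have x: "x \<in> ?D" "\<theta> \<in> sign_vectors N"
      using p feasible by auto
    then obtain m where "m \<in> X" "val m = \<phi> x"
      using \<phi> by (metis imageE imageI)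
    then show "v \<le> peval f p"
      using lower x v \<open>p = x @ \<theta>\<close> unfolding is_minimum_def by (metis order_trans)
  qed
  then have equiv: "tls_equivalent X val r \<beta> c n N f hs gs (set hx) H"
    unfolding tls_equivalent_def
    using v signs \<phi> lower exact attained
    by (intro conjI exI[of _ v] exI[of _ \<phi>]) (auto simp: is_minimum_def)
  have mono: "polys {..<n} \<subseteq> polys {..<n + N}"
    by (auto intro: polys_mono)
  have \<theta>_polys: "\<theta>_constraint (n + i) \<in> polys {..<n + N}" if "i < N" for i
    using bpolysD(1)[OF \<theta>_constraint_bpolys] by (rule polys_mono) (use that in simp)
  have "objective_sparsity n N f"
    unfolding objective_sparsity_def using F f_def bpolysD by blast
  moreover have "constraint_sparsity n N hs gs (set hx) H"
  proof -
    have "\<theta>_constraint (n + i) \<notin> set hx" for i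
      using \<theta>_constraint_notin[of "n + i" "{..<n}"] hx by auto
    moreover have "\<theta>_constraint (n + i) \<noteq> \<theta>_constraint (n + j)" if "i \<noteq> j" for i j
      using \<theta>_constraint_notin[of "n + i" "{n + j}"] bpolysD(1)[OF \<theta>_constraint_bpolys[of "n + j"]] that by auto
    ultimately show ?thesis
      unfolding constraint_sparsity_def
      using hx gs bpolysD(1)[OF \<theta>_constraint_bpolys] by (auto simp: hs_def H_def)
  qed
  moreover have "archimedean_description (n + N) hs (gs @ map (\<lambda>g. 1 - g) gs)"
    unfolding hs_def by (rule archimedean_description_append[OF arch])
  moreover have "\<forall>h\<in>set hs. h \<in> polys {..<n + N} \<and> total_degree h = 2"
    using hx mono \<theta>_polys total_degree_\<theta>_constraint by (auto simp: hs_def)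
  moreover have "\<forall>g\<in>set gs. g \<in> polys {..<n + N} \<and> total_degree g = 2"
    using gs mono by blast
  ultimately show ?thesis
    unfolding has_sparse_pop_def using equiv f bpolysD by blast
qed


section \<open>Rotations\<close>

definition triple :: "real list \<Rightarrow> nat \<Rightarrow> real^3" where
  "triple x k = vector [x ! (3 * k), x ! (3 * k + 1), x ! (3 * k + 2)]"

definition coords :: "real^3 \<Rightarrow> real list" where
  "coords v = [v $ 1, v $ 2, v $ 3]"

definition lin_form :: "real^3 \<Rightarrow> nat \<Rightarrow> real_mpoly" where
  "lin_form u k =
     mConst (u $ 1) * mVar (3 * k) + mConst (u $ 2) * mVar (3 * k + 1) + mConst (u $ 3) * mVar (3 * k + 2)"

definition triple_dot :: "nat \<Rightarrow> nat \<Rightarrow> real_mpoly" where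
  "triple_dot k l =
     mVar (3 * k) * mVar (3 * l) + mVar (3 * k + 1) * mVar (3 * l + 1) + mVar (3 * k + 2) * mVar (3 * l + 2)"

lemma peval_lin_form [simp]: "peval (lin_form u k) x = triple x k \<bullet> u"
  by (simp add: lin_form_def triple_def inner_vec_def sum_3)

lemma peval_triple_dot [simp]: "peval (triple_dot k l) x = triple x k \<bullet> triple x l"
  by (simp add: triple_dot_def triple_def inner_vec_def sum_3)

lemma lin_form_bpolys: "3 * k + 3 \<le> n \<Longrightarrow> lin_form u k \<in> bpolys {..<n} 1"
  unfolding lin_form_def by (intro bpolys_add bpolys_mult_const bpolys_var) auto

lemma triple_dot_bpolys: "3 * k + 3 \<le> n \<Longrightarrow> 3 * l + 3 \<le> n \<Longrightarrow> triple_dot k l \<in> bpolys {..<n} 2"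
  unfolding triple_dot_def by (intro bpolys_add bpolys_mult_linear bpolys_var) auto

text \<open>The variants distinguish a block followed by a tail from a final block, and
  \<open>1\<close> from \<open>Suc 0\<close>, so that each form can be rewritten directly.\<close>

lemma triple_coords [simp]:
  "triple (coords a @ z) 0 = a"
  "triple (coords a @ coords b @ z) 1 = b"
  "triple (coords a @ coords b @ z) (Suc 0) = b"
  "triple (coords a @ coords b @ coords c @ z) 2 = c"
  "triple (coords a @ coords b @ coords c @ coords d) 3 = d"
  "triple (coords a @ coords b) (Suc 0) = b"
  "triple (coords a @ coords b @ coords c) 2 = c"
  by (simp_all add: triple_def coords_def vec_eq_iff forall_3 nth_append)

text \<open>Connects the squared norm in the Archimedean certificate with the row lengths that occur
  in the constraints.\<close>

lemma sum_squares_triples: "(\<Sum>i<3 * k. (mVar i)\<^sup>2) = (\<Sum>j<k. triple_dot j j)"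
proof (induction k)
  case (Suc k)
  have "3 * Suc k = Suc (Suc (Suc (3 * k)))"
    by simp
  then show ?case
    unfolding triple_dot_def using Suc.IH
    by (simp add: triple_dot_def power2_eq_square add.assoc del: mult_Suc_right)
qed simp

section \<open>The rotation group described by rows\<close>

lemma det_rows_3:
  fixes R :: "real^3^3"
  shows "det R = R $ 3 \<bullet> cross3 (R $ 1) (R $ 2)"
  by (simp add: det_3 cross3_def inner_vec_def sum_3 algebra_simps)

text \<open>The cubic condition det R = 1 is traded for the quadratic equation that the third row is
  the cross product of the first two. Conversely, a cross product is orthogonal to its factors, and
  the determinant becomes the squared length of the third row.\<close>

lemma SO3_iff:
  "R \<in> SO3 \<longleftrightarrow> R $ 1 \<bullet> R $ 1 = 1 \<and> R $ 2 \<bullet> R $ 2 = 1 \<and> R $ 3 \<bullet> R $ 3 = 1 \<and>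
     R $ 1 \<bullet> R $ 2 = 0 \<and> R $ 3 = cross3 (R $ 1) (R $ 2)" (is "_ \<longleftrightarrow> ?C")
proof -
  have ortho: "orthogonal_matrix R \<longleftrightarrow> R $ 1 \<bullet> R $ 1 = 1 \<and> R $ 2 \<bullet> R $ 2 = 1 \<and> R $ 3 \<bullet> R $ 3 = 1 \<and>
     R $ 1 \<bullet> R $ 2 = 0 \<and> R $ 1 \<bullet> R $ 3 = 0 \<and> R $ 2 \<bullet> R $ 3 = 0"
    unfolding orthogonal_matrix_orthonormal_rows
    by (auto simp: forall_3 row_def orthogonal_def norm_eq_1 inner_commute)
  show ?thesis
  proof
    assume "R \<in> SO3"
    then have R: "orthogonal_matrix R" "det R = 1"
      by (auto simp: SO3_def rotation_matrix_def)
    have "(norm (cross3 (R $ 1) (R $ 2)))\<^sup>2 = 1"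
      using norm_cross_dot[of "R $ 1" "R $ 2"] R(1) ortho by (simp add: norm_eq_1[symmetric])
    \<comment> \<open>Both vectors have length 1 and their inner product is det R = 1, so the
      squared distance is 1 - 2 + 1.\<close>
    then have "(R $ 3 - cross3 (R $ 1) (R $ 2)) \<bullet> (R $ 3 - cross3 (R $ 1) (R $ 2)) = 0"
      using R ortho by (simp add: det_rows_3 inner_diff inner_commute power2_norm_eq_inner)
    then show ?C
      using R(1) ortho by simp
  next
    assume C: ?C
    then have "orthogonal_matrix R"
      unfolding ortho by (metis dot_cross_self(1,2))
    moreover have "det R = 1"
      using C by (metis det_rows_3)
    ultimately show "R \<in> SO3"
      by (simp add: SO3_def rotation_matrix_def)
  qed
qed

text \<open>The Lagrange identity makes the cross product a unit vector. Shape alignment uses this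
  to recover a rotation from two rows.\<close>

lemma SO3_completion:
  assumes "norm a = 1" "norm b = 1" "a \<bullet> b = 0"
  shows "vector [a, b, cross3 a b] \<in> SO3"
proof -
  have "cross3 a b \<bullet> cross3 a b = 1"
    using norm_cross_dot[of a b] assms by (simp add: power2_norm_eq_inner)
  then show ?thesis
    using assms by (simp add: SO3_iff norm_eq_1)
qed

lemma SO3_inner:
  assumes "R \<in> SO3"
  shows "(R *v a) \<bullet> (R *v b) = a \<bullet> b"
proof -
  \<comment> \<open>\<open>v*\<close> is multiplication by the transpose; moving R across the inner
    product leaves \<open>transpose R ** R\<close>, the identity.\<close>
  have "(R *v a) v* R = transpose R ** R *v a"
    by (simp flip: matrix_vector_mul_assoc)
  then have "(R *v a) v* R = a"
    using assms by (simp add: SO3_def rotation_matrix_def orthogonal_matrix_def)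
  then show ?thesis
    by (metis dot_lmul_matrix)
qed

lemma SO3_norm: "R \<in> SO3 \<Longrightarrow> norm (R *v a) = norm a"
  by (simp add: norm_eq_sqrt_inner SO3_inner)

lemma SO3_transpose:
  assumes "R \<in> SO3"
  shows "R *v (transpose R *v t) = t"
  using assms by (simp add: SO3_def rotation_matrix_def orthogonal_matrix_def matrix_vector_mul_assoc
      del: transpose_matrix_vector)

lemma mat_1_SO3: "mat 1 \<in> SO3"
  by (simp add: SO3_def rotation_matrix_def orthogonal_matrix_id)

text \<open>Unit rows bound the Frobenius norm by sqrt 3, and the row equations are closed
  conditions.\<close>

lemma compact_SO3: "compact SO3"
proof (rule compact_eq_bounded_closed[THEN iffD2], rule conjI)
  have "norm R \<le> sqrt 3" if "R \<in> SO3" for R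
  proof -
    have "R $ 1 \<bullet> R $ 1 = 1" "R $ 2 \<bullet> R $ 2 = 1" "R $ 3 \<bullet> R $ 3 = 1"
      using that unfolding SO3_iff by blast+
    then show ?thesis
      by (simp add: norm_eq_sqrt_inner inner_vec_def[of R] sum_3)
  qed
  then show "bounded SO3"
    by (auto simp: bounded_iff)
  have "closed {R::real^3^3. R $ 1 \<bullet> R $ 1 = 1 \<and> R $ 2 \<bullet> R $ 2 = 1 \<and> R $ 3 \<bullet> R $ 3 = 1 \<and>
     R $ 1 \<bullet> R $ 2 = 0 \<and> R $ 3 = cross3 (R $ 1) (R $ 2)}"
    by (intro closed_Collect_conj closed_Collect_eq continuous_intros continuous_on_cross)
  then show "closed SO3"
    by (simp add: SO3_iff[symmetric])
qed

lemma continuous_on_matrix_vector_mult [continuous_intros]: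
  fixes f :: "'a::topological_space \<Rightarrow> real^'n^'m"
  assumes "continuous_on S f" "continuous_on S g"
  shows "continuous_on S (\<lambda>z. f z *v g z)"
  unfolding matrix_vector_mult_def by (intro continuous_intros assms)

section \<open>Single rotation averaging\<close>

definition matrix_of :: "real list \<Rightarrow> real^3^3" where
  "matrix_of x = vector [triple x 0, triple x 1, triple x 2]"

text \<open>The last three entries are the coordinates of the cross-product equation for rows stored
  in variables 0 to 8. The unit-length equations come first, so that \<open>j < 3\<close> selects
  them in certificates.\<close>

definition rotation_constraints :: "real_mpoly list" where
  "rotation_constraints =
     [triple_dot 0 0 - 1, triple_dot 1 1 - 1, triple_dot 2 2 - 1, triple_dot 0 1,
      mVar 6 - (mVar 1 * mVar 5 - mVar 2 * mVar 4),
      mVar 7 - (mVar 2 * mVar 3 - mVar 0 * mVar 5),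
      mVar 8 - (mVar 0 * mVar 4 - mVar 1 * mVar 3)]"

lemma peval_rotation_constraints:
  "(\<forall>h\<in>set rotation_constraints. peval h x = 0) \<longleftrightarrow> matrix_of x \<in> SO3"
proof -
  have "triple x 2 = cross3 (triple x 0) (triple x 1) \<longleftrightarrow>
     x ! 6 = x ! 1 * x ! 5 - x ! 2 * x ! 4 \<and> x ! 7 = x ! 2 * x ! 3 - x ! 0 * x ! 5 \<and>
     x ! 8 = x ! 0 * x ! 4 - x ! 1 * x ! 3"
    by (simp add: vec_eq_iff forall_3 cross3_def triple_def numeral_2_eq_2)
  then show ?thesis
    by (simp add: rotation_constraints_def SO3_iff matrix_of_def)
qed

lemma rotation_constraints_quadratic:
  assumes "h \<in> set rotation_constraints" "9 \<le> n"
  shows "h \<in> polys {..<n} \<and> total_degree h = 2"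
proof -
  have b: "h \<in> bpolys {..<9} 2"
    using assms(1) unfolding rotation_constraints_def
    by (auto intro!: bpolys_diff bpolys_mult_linear bpolys_var triple_dot_bpolys)
  \<comment> \<open>The second difference is twice the quadratic part at p. At p = (0, ..., 8) the
    quadratic parts of all seven equations are nonzero.\<close>
  have "total_degree h = 2"
    by (rule total_degree_eq_2I[where p = "map real [0..<9]"])
       (use assms(1) b in \<open>auto simp: rotation_constraints_def triple_def inner_vec_def sum_3\<close>)
  then show ?thesis
    using bpolysD(1)[OF b] assms(2) by (auto intro: polys_mono)
qed

lemma sum_rotation_constraints:
  "(\<Sum>j<length rotation_constraints. (if j < 3 then - 1 else 0) * rotation_constraints ! j) =
     mConst 3 - (triple_dot 0 0 + triple_dot 1 1 + triple_dot 2 2)"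
  by (simp add: rotation_constraints_def lessThan_Suc mConst_numeral)

lemma archimedean_rotation: "archimedean_description 9 rotation_constraints []"
  unfolding archimedean_description_def
proof (intro exI conjI)
  have "(\<Sum>i<9. (mVar i)\<^sup>2) = triple_dot 0 0 + triple_dot 1 1 + triple_dot 2 2"
    using sum_squares_triples[of 3] by (simp add: eval_nat_numeral)
  \<comment> \<open>This equation fixes the witnesses: the constant is 3 because three unit rows
    have total squared length 3.\<close>
  then show "mConst 3 - (\<Sum>i<9. (mVar i)\<^sup>2) =
      (\<Sum>j<length rotation_constraints. (if j < 3 then - 1 else 0) * rotation_constraints ! j) +
      (\<Sum>k<length []. 0 * [] ! k)"
    unfolding sum_rotation_constraints by simp
qed (use polys_mConst[of "- 1"] polys_mConst[of 0] in \<open>auto simp: mConst_minus mConst_1\<close>)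

lemma norm_matrix_3:
  fixes A :: "real^3^3"
  shows "(norm A)\<^sup>2 = (norm (A $ 1))\<^sup>2 + (norm (A $ 2))\<^sup>2 + (norm (A $ 3))\<^sup>2"
  by (simp add: power2_norm_eq_inner inner_vec_def[of A] sum_3)

definition dist_poly :: "nat \<Rightarrow> real^3 \<Rightarrow> real_mpoly" where
  "dist_poly k v = (mVar (3 * k) - mConst (v $ 1))\<^sup>2 + (mVar (3 * k + 1) - mConst (v $ 2))\<^sup>2
     + (mVar (3 * k + 2) - mConst (v $ 3))\<^sup>2"

lemma peval_dist_poly [simp]: "peval (dist_poly k v) x = (norm (triple x k - v))\<^sup>2"
  by (simp add: dist_poly_def power2_norm_eq_inner inner_vec_def sum_3 triple_def flip: power2_eq_square)

lemma dist_poly_bpolys: "3 * k + 3 \<le> n \<Longrightarrow> dist_poly k v \<in> bpolys {..<n} 2"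
  unfolding dist_poly_def by (intro bpolys_add bpolys_square_linear bpolys_diff bpolys_var) auto

lemma length_coords [simp]: "length (coords v) = 3"
  by (simp add: coords_def)

lemma matrix_of_coords [simp]:
  "matrix_of (coords (R $ 1) @ coords (R $ 2) @ coords (R $ 3)) = R"
  "matrix_of (coords (R $ 1) @ coords (R $ 2) @ coords (R $ 3) @ z) = R"
  by (simp_all add: matrix_of_def vec_eq_iff[of _ R] forall_3[of "\<lambda>i. _ $ i = R $ i"])

lemma rotation_pop:
  assumes "\<And>i. i < N \<Longrightarrow> \<beta> i > 0"
  shows "has_sparse_pop SO3 (\<lambda>R. R) (rotation_residual y) N \<beta> c"
proof (rule has_sparse_popI[where n = 9 and hx = rotation_constraints and gs = "[]" and \<phi> = matrix_of
      and q = "\<lambda>i. dist_poly 0 (y i $ 1) + dist_poly 1 (y i $ 2) + dist_poly 2 (y i $ 3)"])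
  show "matrix_of ` x_domain 9 (set rotation_constraints) [] = (\<lambda>R. R) ` SO3"
  proof (intro equalityI subsetI; clarsimp)
    fix x assume "x \<in> x_domain 9 (set rotation_constraints) []"
    then show "matrix_of x \<in> SO3"
      using peval_rotation_constraints by (simp add: x_domain_def)
  next
    fix R assume "R \<in> SO3"
    then have "coords (R $ 1) @ coords (R $ 2) @ coords (R $ 3) \<in> x_domain 9 (set rotation_constraints) []"
      by (simp add: x_domain_def peval_rotation_constraints)
    then show "R \<in> matrix_of ` x_domain 9 (set rotation_constraints) []"
      by (metis imageI matrix_of_coords(1))
  qed
  show "peval (dist_poly 0 (y i $ 1) + dist_poly 1 (y i $ 2) + dist_poly 2 (y i $ 3)) x = (rotation_residual y R i)\<^sup>2"
    if "R = matrix_of x" for i x R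
    by (simp add: that rotation_residual_def norm_matrix_3 matrix_of_def)
  show "continuous_on SO3 (\<lambda>R. rotation_residual y R i)" for i
    unfolding rotation_residual_def by (intro continuous_intros)
qed (use assms mat_1_SO3 compact_SO3 archimedean_rotation rotation_constraints_quadratic in
      \<open>auto intro!: bpolys_add dist_poly_bpolys\<close>)

section \<open>Rigid motions\<close>

text \<open>Scaled so that 0 \<le> g \<le> 1 describes exactly the ball of radius T: the upper bound
  says that a square is nonnegative.\<close>

definition ball_constraint :: "real \<Rightarrow> real_mpoly" where
  "ball_constraint T = 1 - mConst (1 / T\<^sup>2) * triple_dot 3 3"

lemma ball_constraint_quadratic:
  assumes "T > 0"
  shows "ball_constraint T \<in> polys {..<12} \<and> total_degree (ball_constraint T) = 2"
proof -
  have b: "ball_constraint T \<in> bpolys {..<12} 2"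
    unfolding ball_constraint_def by (intro bpolys_diff bpolys_mult_const triple_dot_bpolys) auto
  moreover have "total_degree (ball_constraint T) = 2"
    by (rule total_degree_eq_2I[where p = "map real [0..<12]"])
       (use assms b in \<open>auto simp: ball_constraint_def triple_def inner_vec_def sum_3 field_simps\<close>)
  ultimately show ?thesis
    using bpolysD by blast
qed

lemma peval_ball_constraint:
  assumes "T > 0"
  shows "0 \<le> peval (ball_constraint T) x \<and> peval (ball_constraint T) x \<le> 1 \<longleftrightarrow> norm (triple x 3) \<le> T"
proof -
  have "peval (ball_constraint T) x = 1 - (norm (triple x 3))\<^sup>2 / T\<^sup>2"
    by (simp add: ball_constraint_def power2_norm_eq_inner)
  then show ?thesis
    using assms by (auto simp: divide_le_eq power_mono_iff)
qed

text \<open>The multiplier T^2, a square, undoes the scaling of the ball constraint. Adding the row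
  equations leaves 3 + T^2 minus the squared norm.\<close>

lemma archimedean_rigid:
  assumes "T > 0"
  shows "archimedean_description 12 rotation_constraints [ball_constraint T]"
  unfolding archimedean_description_def
proof (intro exI conjI)
  have T: "mConst (T\<^sup>2) * mConst (1 / T\<^sup>2) = 1"
    using assms by (simp add: mConst_1 flip: mConst_mult)
  have "mConst (T\<^sup>2) * ball_constraint T = mConst (T\<^sup>2) - (mConst (T\<^sup>2) * mConst (1 / T\<^sup>2)) * triple_dot 3 3"
    unfolding ball_constraint_def by (simp only: right_diff_distrib mult_1_right mult.assoc)
  then have "mConst (T\<^sup>2) * ball_constraint T = mConst (T\<^sup>2) - triple_dot 3 3"
    unfolding T by simp
  moreover have "(\<Sum>i<12. (mVar i)\<^sup>2) = triple_dot 0 0 + triple_dot 1 1 + triple_dot 2 2 + triple_dot 3 3"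
    using sum_squares_triples[of 4] by (simp add: eval_nat_numeral)
  ultimately show "mConst (3 + T\<^sup>2) - (\<Sum>i<12. (mVar i)\<^sup>2) =
      (\<Sum>j<length rotation_constraints. (if j < 3 then - 1 else 0) * rotation_constraints ! j) +
      (\<Sum>k<length [ball_constraint T]. mConst (T\<^sup>2) * [ball_constraint T] ! k)"
    unfolding sum_rotation_constraints by (simp add: mConst_add)
qed (use polys_mConst[of "- 1"] polys_mConst[of 0] assms sum_of_squares_mConst
     in \<open>auto simp: mConst_minus mConst_1 add_pos_nonneg\<close>)

lemma x_domain_rigid:
  assumes "T > 0"
  shows "x_domain 12 (set rotation_constraints) [ball_constraint T] =
    {x. length x = 12 \<and> matrix_of x \<in> SO3 \<and> norm (triple x 3) \<le> T}"
  using assms by (simp add: x_domain_def peval_rotation_constraints peval_ball_constraint)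

text \<open>Triples 0, 1, 2 of the variable are the rows of \<open>R\<close>; triple 3 is the preimage of \<open>t\<close> under \<open>tr R\<close>.\<close>

lemma rigid_popI:
  assumes "\<And>i. i < N \<Longrightarrow> \<beta> i > 0" and T: "T > 0"
    and "\<And>i. i < N \<Longrightarrow> q i \<in> bpolys {..<12} 2"
    and "(\<lambda>x. (matrix_of x, tr (matrix_of x) (triple x 3))) `
      {x. length x = 12 \<and> matrix_of x \<in> SO3 \<and> norm (triple x 3) \<le> T} = rigid_models T"
    and "\<And>i x. i < N \<Longrightarrow> matrix_of x \<in> SO3 \<Longrightarrow>
      peval (q i) x = (r (matrix_of x, tr (matrix_of x) (triple x 3)) i)\<^sup>2"
    and "\<And>i. i < N \<Longrightarrow> continuous_on UNIV (\<lambda>m. r m i)"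
  shows "has_sparse_pop (rigid_models T) (\<lambda>m. m) r N \<beta> c"
proof (rule has_sparse_popI[where n = 12 and hx = rotation_constraints and gs = "[ball_constraint T]"
      and \<phi> = "\<lambda>x. (matrix_of x, tr (matrix_of x) (triple x 3))" and q = q])
  show "compact (rigid_models T)"
    unfolding rigid_models_def using compact_SO3 compact_cball[of "0::real^3" T]
    by (intro compact_Times) (auto simp: cball_def)
  show "rigid_models T \<noteq> {}"
    using mat_1_SO3 T by (auto simp: rigid_models_def intro!: exI[of _ 0])
  show "continuous_on (rigid_models T) (\<lambda>m. r m i)" if "i < N" for i
    using assms(6)[OF that] by (rule continuous_on_subset) simp
qed (use assms archimedean_rigid[OF T] rotation_constraints_quadratic[where n = 12] ball_constraint_quadratic[OF T] in
      \<open>auto simp: x_domain_rigid[OF T]\<close>)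

text \<open>Norm preservation carries the bound T between the stored triple and the translation in
  both directions; the right inverse \<open>tr'\<close> supplies the preimage of a given t.\<close>

lemma rigid_parametrization:
  assumes T: "T > 0"
    and tr: "\<And>R t. R \<in> SO3 \<Longrightarrow> norm (tr R t) = norm t"
    and inv: "\<And>R t. R \<in> SO3 \<Longrightarrow> tr R (tr' R t) = t"
  shows "(\<lambda>x. (matrix_of x, tr (matrix_of x) (triple x 3))) `
      {x. length x = 12 \<and> matrix_of x \<in> SO3 \<and> norm (triple x 3) \<le> T} = rigid_models T"
    (is "?\<phi> ` ?D = _")
proof (intro equalityI subsetI)
  fix m assume "m \<in> ?\<phi> ` ?D"
  then show "m \<in> rigid_models T"
    using tr by (auto simp: rigid_models_def)
next
  fix m assume "m \<in> rigid_models T"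
  then obtain R t where m: "m = (R, t)" "R \<in> SO3" "norm t \<le> T"
    by (auto simp: rigid_models_def)
  let ?x = "coords (R $ 1) @ coords (R $ 2) @ coords (R $ 3) @ coords (tr' R t)"
  have "norm (tr' R t) = norm t"
    using tr[of R "tr' R t"] inv m by simp
  then have "?x \<in> ?D"
    using m by simp
  moreover have "m = ?\<phi> ?x"
    using m inv by simp
  ultimately show "m \<in> ?\<phi> ` ?D"
    by blast
qed

section \<open>Point cloud registration\<close>

lemma norm_3: "(norm v)\<^sup>2 = (v $ 1)\<^sup>2 + (v $ 2)\<^sup>2 + (v $ 3)\<^sup>2" for v :: "real^3"
  unfolding power2_norm_eq_inner by (simp add: inner_vec_def sum_3 power2_eq_square)

lemma matrix_of_mult_component:
  "(matrix_of x *v a) $ 1 = triple x 0 \<bullet> a"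
  "(matrix_of x *v a) $ 2 = triple x 1 \<bullet> a"
  "(matrix_of x *v a) $ 3 = triple x 2 \<bullet> a"
  by (simp_all add: matrix_of_def matrix_vector_mul_component)

lemma triple_component:
  "triple x k $ 1 = x ! (3 * k)" "triple x k $ 2 = x ! (3 * k + 1)" "triple x k $ 3 = x ! (3 * k + 2)"
  by (simp_all add: triple_def)

text \<open>Variables 9 to 11 hold t itself, which makes every coordinate of b - R a - t
  affine.\<close>

definition cloud_poly :: "real^3 \<Rightarrow> real^3 \<Rightarrow> real_mpoly" where
  "cloud_poly a b = (mConst (b $ 1) - lin_form a 0 - mVar 9)\<^sup>2 + (mConst (b $ 2) - lin_form a 1 - mVar 10)\<^sup>2
     + (mConst (b $ 3) - lin_form a 2 - mVar 11)\<^sup>2"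

lemma point_cloud_pop:
  assumes "\<And>i. i < N \<Longrightarrow> \<beta> i > 0" and T: "T > 0"
  shows "has_sparse_pop (rigid_models T) (\<lambda>m. m) (point_cloud_residual y) N \<beta> c"
proof (rule rigid_popI[where tr = "\<lambda>R t. t" and q = "\<lambda>i. case y i of (a, b) \<Rightarrow> cloud_poly a b"])
  fix i
  obtain a b where y: "y i = (a, b)"
    by fastforce
  show "(case y i of (a, b) \<Rightarrow> cloud_poly a b) \<in> bpolys {..<12} 2"
    unfolding y cloud_poly_def prod.case
    by (intro bpolys_add bpolys_square_linear bpolys_diff bpolys_var lin_form_bpolys) auto
  show "peval (case y i of (a, b) \<Rightarrow> cloud_poly a b) x = (point_cloud_residual y (matrix_of x, triple x 3) i)\<^sup>2" for x
    by (simp add: y cloud_poly_def norm_3 matrix_of_mult_component triple_component)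
  have "continuous_on UNIV (\<lambda>m :: (real^3^3) \<times> (real^3). norm (b - fst m *v a - snd m))"
    by (intro continuous_intros)
  moreover have "point_cloud_residual y m i = norm (b - fst m *v a - snd m)" for m
    by (cases m) (simp add: y)
  ultimately show "continuous_on UNIV (\<lambda>m. point_cloud_residual y m i)"
    by simp
qed (use assms rigid_parametrization[OF T, of "\<lambda>R t. t" "\<lambda>R t. t"] in auto)

section \<open>Mesh registration\<close>

text \<open>
  In the variable \<open>t' = R\<^sup>T t\<close> the point-to-plane residual
  \<open>(R u) \<bullet> (b - R a - t) = (R u) \<bullet> b - u \<bullet> a - u \<bullet> t'\<close> is affine in \<open>(R, t')\<close>.
\<close>

definition mesh_poly :: "real \<Rightarrow> real^3 \<Rightarrow> real^3 \<Rightarrow> real^3 \<Rightarrow> real^3 \<Rightarrow> real_mpoly" where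
  "mesh_poly w a u b v =
     (mConst (b $ 1) * lin_form u 0 + mConst (b $ 2) * lin_form u 1 + mConst (b $ 3) * lin_form u 2
        - mConst (u \<bullet> a) - lin_form u 3)\<^sup>2 +
     mConst w * ((mConst (v $ 1) - lin_form u 0)\<^sup>2 + (mConst (v $ 2) - lin_form u 1)\<^sup>2
        + (mConst (v $ 3) - lin_form u 2)\<^sup>2)"

lemma mesh_pop:
  assumes "\<And>i. i < N \<Longrightarrow> \<beta> i > 0" and T: "T > 0" and w: "\<And>i. i < N \<Longrightarrow> w i > 0"
  shows "has_sparse_pop (rigid_models T) (\<lambda>m. m) (mesh_residual w y) N \<beta> c"
proof (rule rigid_popI[where tr = "(*v)" and q = "\<lambda>i. case y i of (a, u, b, v) \<Rightarrow> mesh_poly (w i) a u b v"])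
  fix i assume i: "i < N"
  obtain a u b v where y: "y i = (a, u, b, v)"
    by (metis prod_cases4)
  show "(case y i of (a, u, b, v) \<Rightarrow> mesh_poly (w i) a u b v) \<in> bpolys {..<12} 2"
    unfolding y mesh_poly_def prod.case
    by (intro bpolys_add bpolys_square_linear bpolys_mult_const bpolys_diff bpolys_var lin_form_bpolys) auto
  show "peval (case y i of (a, u, b, v) \<Rightarrow> mesh_poly (w i) a u b v) x =
      (mesh_residual w y (matrix_of x, matrix_of x *v triple x 3) i)\<^sup>2"
    if R: "matrix_of x \<in> SO3" for x
  proof -
    let ?R = "matrix_of x"
    \<comment> \<open>Orthogonality removes R from the products of R u with R a and with R t'. This
      is where membership in \<open>SO3\<close> enters.\<close>
    have "(?R *v u) \<bullet> (b - ?R *v a - ?R *v triple x 3) = (?R *v u) \<bullet> b - u \<bullet> a - triple x 3 \<bullet> u"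
      by (simp add: inner_diff_right SO3_inner[OF R] inner_commute)
    also have "(?R *v u) \<bullet> b = b $ 1 * (triple x 0 \<bullet> u) + b $ 2 * (triple x 1 \<bullet> u) + b $ 3 * (triple x 2 \<bullet> u)"
      by (simp add: inner_vec_def[of _ b] sum_3 matrix_of_mult_component)
    finally have plane: "(?R *v u) \<bullet> (b - ?R *v a - ?R *v triple x 3) =
      b $ 1 * (triple x 0 \<bullet> u) + b $ 2 * (triple x 1 \<bullet> u) + b $ 3 * (triple x 2 \<bullet> u) - u \<bullet> a - triple x 3 \<bullet> u" .
    have normal: "(norm (v - ?R *v u))\<^sup>2 =
      (v $ 1 - triple x 0 \<bullet> u)\<^sup>2 + (v $ 2 - triple x 1 \<bullet> u)\<^sup>2 + (v $ 3 - triple x 2 \<bullet> u)\<^sup>2"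
      by (simp add: norm_3 matrix_of_mult_component)
    \<comment> \<open>The weight is positive, so the radicand is nonnegative and squaring cancels
      the root.\<close>
    have "(mesh_residual w y (?R, ?R *v triple x 3) i)\<^sup>2 =
      ((?R *v u) \<bullet> (b - ?R *v a - ?R *v triple x 3))\<^sup>2 + w i * (norm (v - ?R *v u))\<^sup>2"
      using w[OF i] by (simp add: y)
    then show ?thesis
      unfolding plane normal by (simp add: y mesh_poly_def)
  qed
  have "continuous_on UNIV (\<lambda>m :: (real^3^3) \<times> (real^3).
      sqrt (((fst m *v u) \<bullet> (b - fst m *v a - snd m))\<^sup>2 + w i * (norm (v - fst m *v u))\<^sup>2))"
    by (intro continuous_intros)
  moreover have "mesh_residual w y m i =
      sqrt (((fst m *v u) \<bullet> (b - fst m *v a - snd m))\<^sup>2 + w i * (norm (v - fst m *v u))\<^sup>2)" for m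
    by (cases m) (simp add: y)
  ultimately show "continuous_on UNIV (\<lambda>m. mesh_residual w y m i)"
    by simp
qed (use assms rigid_parametrization[OF T, of "(*v)" "\<lambda>R t. transpose R *v t"] SO3_norm SO3_transpose in auto)

section \<open>Shape alignment\<close>

text \<open>
  The variable is the matrix \<open>s \<Pi> R\<close>, whose values are the matrices
  with two orthogonal rows of the same norm at most \<open>sbar\<close>.
\<close>

definition shape_constraints :: "real_mpoly list" where
  "shape_constraints = [triple_dot 0 1, triple_dot 0 0 - triple_dot 1 1]"

text \<open>For rows of common length s the subtracted term is s^2 / sbar^2, whence the factor 2.
  Using both rows puts all six squared variables into this one constraint.\<close>

definition scale_constraint :: "real \<Rightarrow> real_mpoly" where
  "scale_constraint sbar = 1 - mConst (1 / (2 * sbar\<^sup>2)) * (triple_dot 0 0 + triple_dot 1 1)"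

lemma shape_constraints_quadratic:
  assumes "h \<in> set shape_constraints"
  shows "h \<in> polys {..<6} \<and> total_degree h = 2"
proof -
  have b: "h \<in> bpolys {..<6} 2"
    using assms unfolding shape_constraints_def
    by (auto intro!: bpolys_diff triple_dot_bpolys)
  moreover have "total_degree h = 2"
    by (rule total_degree_eq_2I[where p = "map real [0..<6]"])
       (use assms b in \<open>auto simp: shape_constraints_def triple_def inner_vec_def sum_3\<close>)
  ultimately show ?thesis
    using bpolysD by blast
qed

lemma scale_constraint_quadratic:
  assumes "sbar > 0"
  shows "scale_constraint sbar \<in> polys {..<6} \<and> total_degree (scale_constraint sbar) = 2"
proof -
  have b: "scale_constraint sbar \<in> bpolys {..<6} 2"
    unfolding scale_constraint_def by (intro bpolys_diff bpolys_mult_const bpolys_add triple_dot_bpolys) auto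
  moreover have "total_degree (scale_constraint sbar) = 2"
    by (rule total_degree_eq_2I[where p = "map real [0..<6]"])
       (use assms b in \<open>auto simp: scale_constraint_def triple_def inner_vec_def sum_3 field_simps\<close>)
  ultimately show ?thesis
    using bpolysD by blast
qed

lemma x_domain_shape:
  assumes "sbar > 0"
  shows "x_domain 6 (set shape_constraints) [scale_constraint sbar] =
    {x. length x = 6 \<and> triple x 0 \<bullet> triple x 1 = 0 \<and>
      norm (triple x 0) = norm (triple x 1) \<and> norm (triple x 0) \<le> sbar}"
proof -
  have "0 \<le> peval (scale_constraint sbar) x \<and> peval (scale_constraint sbar) x \<le> 1 \<longleftrightarrow> norm (triple x 0) \<le> sbar"
    if "norm (triple x 0) = norm (triple x 1)" for x
  proof -
    have "peval (scale_constraint sbar) x = 1 - (norm (triple x 0))\<^sup>2 / sbar\<^sup>2"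
      using assms that by (simp add: scale_constraint_def flip: power2_norm_eq_inner)
    then show ?thesis
      using assms by (auto simp: divide_le_eq power_mono_iff)
  qed
  then show ?thesis
    by (simp add: x_domain_def shape_constraints_def norm_eq) blast
qed

text \<open>The scale inequality times 2 sbar^2 is already 2 sbar^2 minus the squared norm, so the
  equations take multiplier 0.\<close>

lemma archimedean_shape:
  assumes "sbar > 0"
  shows "archimedean_description 6 shape_constraints [scale_constraint sbar]"
  unfolding archimedean_description_def
proof (intro exI conjI)
  have S: "mConst (2 * sbar\<^sup>2) * mConst (1 / (2 * sbar\<^sup>2)) = 1"
    using assms by (simp add: mConst_1 flip: mConst_mult)
  have "mConst (2 * sbar\<^sup>2) * scale_constraint sbar = mConst (2 * sbar\<^sup>2)
      - (mConst (2 * sbar\<^sup>2) * mConst (1 / (2 * sbar\<^sup>2))) * (triple_dot 0 0 + triple_dot 1 1)"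
    unfolding scale_constraint_def by (simp only: right_diff_distrib mult_1_right mult.assoc)
  then have "mConst (2 * sbar\<^sup>2) * scale_constraint sbar = mConst (2 * sbar\<^sup>2) - (triple_dot 0 0 + triple_dot 1 1)"
    unfolding S by simp
  moreover have "(\<Sum>i<6. (mVar i)\<^sup>2) = triple_dot 0 0 + triple_dot 1 1"
    using sum_squares_triples[of 2] by (simp add: eval_nat_numeral)
  ultimately show "mConst (2 * sbar\<^sup>2) - (\<Sum>i<6. (mVar i)\<^sup>2) =
      (\<Sum>j<length shape_constraints. 0 * shape_constraints ! j) +
      (\<Sum>k<length [scale_constraint sbar]. mConst (2 * sbar\<^sup>2) * [scale_constraint sbar] ! k)"
    by simp
qed (use polys_mConst[of 0] assms sum_of_squares_mConst[of "2 * sbar\<^sup>2"] in auto)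

section \<open>Matrices of the form s \<Pi> R\<close>

definition shape_matrix :: "real list \<Rightarrow> real^3^2" where
  "shape_matrix x = vector [triple x 0, triple x 1]"

lemma shape_value_eq: "shape_value (R, s) = vector [s *\<^sub>R R $ 1, s *\<^sub>R R $ 2]"
  by (simp add: vec_eq_iff forall_2 forall_3 matrix_matrix_mult_def proj_matrix_def sum_3)

lemma shape_residual_eq:
  assumes "y i = (B, b)"
  shows "shape_residual y m i = norm (b - shape_value m *v B)"
  using assms by (cases m) (simp add: scaleR_matrix_vector_assoc matrix_vector_mul_assoc)

text \<open>Two orthogonal rows of equal length s > 0 become orthonormal after division by s, and
  their cross product completes them to a rotation.\<close>

lemma shape_parametrization:
  assumes "sbar > 0"
  shows "shape_matrix ` {x. length x = 6 \<and> triple x 0 \<bullet> triple x 1 = 0 \<and>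
      norm (triple x 0) = norm (triple x 1) \<and> norm (triple x 0) \<le> sbar} =
    shape_value ` shape_models sbar" (is "_ ` ?D = _")
proof (intro equalityI subsetI)
  fix A assume "A \<in> shape_matrix ` ?D"
  then obtain x where x: "x \<in> ?D" and A: "A = shape_matrix x"
    by blast
  let ?a = "triple x 0" and ?b = "triple x 1"
  define s where "s = norm ?a"
  show "A \<in> shape_value ` shape_models sbar"
  \<comment> \<open>At scale 0 the matrix vanishes and does not determine a rotation; the identity
    is chosen.\<close>
  proof (cases "s = 0")
    case True
    then have "?a = 0" "?b = 0"
      using x by (auto simp: s_def)
    then have "A = shape_value (mat 1, 0)"
      unfolding A shape_matrix_def shape_value_eq by simp
    moreover have "(mat 1, 0) \<in> shape_models sbar"
      using mat_1_SO3 assms by (simp add: shape_models_def)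
    ultimately show ?thesis
      by blast
  next
    case False
    let ?a' = "?a /\<^sub>R s" and ?b' = "?b /\<^sub>R s"
    define R :: "real^3^3" where "R = vector [?a', ?b', cross3 ?a' ?b']"
    have "norm ?a' = 1" "norm ?b' = 1" "?a' \<bullet> ?b' = 0"
      using x False by (auto simp: s_def)
    then have "R \<in> SO3"
      unfolding R_def by (rule SO3_completion)
    then have "(R, s) \<in> shape_models sbar"
      using x by (simp add: shape_models_def s_def)
    moreover have "A = shape_value (R, s)"
      unfolding A shape_matrix_def shape_value_eq R_def using False by simp
    ultimately show ?thesis
      by blast
  qed
next
  fix A assume "A \<in> shape_value ` shape_models sbar"
  then obtain R s where R: "R \<in> SO3" "0 \<le> s" "s \<le> sbar" and A: "A = shape_value (R, s)"
    by (auto simp: shape_models_def)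
  let ?x = "coords (s *\<^sub>R R $ 1) @ coords (s *\<^sub>R R $ 2)"
  have "norm (R $ 1) = 1" "norm (R $ 2) = 1" "R $ 1 \<bullet> R $ 2 = 0"
    using R(1) by (auto simp: SO3_iff norm_eq_1)
  then have "?x \<in> ?D"
    using R by simp
  moreover have "A = shape_matrix ?x"
    unfolding A shape_matrix_def shape_value_eq by simp
  ultimately show "A \<in> shape_matrix ` ?D"
    by blast
qed

lemma norm_2: "(norm v)\<^sup>2 = (v $ 1)\<^sup>2 + (v $ 2)\<^sup>2" for v :: "real^2"
  unfolding power2_norm_eq_inner by (simp add: inner_vec_def sum_2 power2_eq_square)

definition shape_poly :: "real^3 \<Rightarrow> real^2 \<Rightarrow> real_mpoly" where
  "shape_poly B b = (mConst (b $ 1) - lin_form B 0)\<^sup>2 + (mConst (b $ 2) - lin_form B 1)\<^sup>2"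

lemma shape_pop:
  assumes "\<And>i. i < N \<Longrightarrow> \<beta> i > 0" and sbar: "sbar > 0"
  shows "has_sparse_pop (shape_models sbar) shape_value (shape_residual y) N \<beta> c"
proof (rule has_sparse_popI[where n = 6 and hx = shape_constraints and gs = "[scale_constraint sbar]"
      and \<phi> = shape_matrix and q = "\<lambda>i. case y i of (B, b) \<Rightarrow> shape_poly B b"])
  show "compact (shape_models sbar)"
    unfolding shape_models_def using compact_SO3 by (intro compact_Times) auto
  show "shape_models sbar \<noteq> {}"
    using mat_1_SO3 sbar by (auto simp: shape_models_def intro!: exI[of _ 0])
  show "shape_matrix ` x_domain 6 (set shape_constraints) [scale_constraint sbar] = shape_value ` shape_models sbar"
    unfolding x_domain_shape[OF sbar] by (rule shape_parametrization[OF sbar])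
  fix i
  obtain B b where y: "y i = (B, b)"
    by fastforce
  show "(case y i of (B, b) \<Rightarrow> shape_poly B b) \<in> bpolys {..<6} 2"
    unfolding y shape_poly_def prod.case
    by (intro bpolys_add bpolys_square_linear bpolys_diff lin_form_bpolys) auto
  \<comment> \<open>The residual factors through \<open>shape_value\<close>, so the identity holds
    for every model with that value.\<close>
  show "peval (case y i of (B, b) \<Rightarrow> shape_poly B b) x = (shape_residual y m i)\<^sup>2"
    if "shape_value m = shape_matrix x" for x m
    unfolding shape_residual_eq[of y i, OF y] that
    by (simp add: y shape_poly_def norm_2 matrix_vector_mul_component shape_matrix_def)
  have "continuous_on S (\<lambda>m :: (real^3^3) \<times> real. norm (b - snd m *\<^sub>R (proj_matrix *v (fst m *v B))))" for S
    by (intro continuous_intros)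
  moreover have "shape_residual y m i = norm (b - snd m *\<^sub>R (proj_matrix *v (fst m *v B)))" for m
    by (cases m) (simp add: y)
  ultimately show "continuous_on (shape_models sbar) (\<lambda>m. shape_residual y m i)"
    by simp
qed (use assms archimedean_shape[OF sbar] shape_constraints_quadratic scale_constraint_quadratic[OF sbar] in auto)

theorem proposition5:
  fixes N :: nat and \<beta> :: "nat \<Rightarrow> real" and c sbar T :: real
    and w :: "nat \<Rightarrow> real"
    and y_rot :: "nat \<Rightarrow> real^3^3"
    and y_shape :: "nat \<Rightarrow> (real^3) \<times> (real^2)"
    and y_cloud :: "nat \<Rightarrow> (real^3) \<times> (real^3)"
    and y_mesh :: "nat \<Rightarrow> (real^3) \<times> (real^3) \<times> (real^3) \<times> (real^3)"
  assumes "N \<ge> 1" and "\<forall>i<N. \<beta> i > 0" and "c > 0"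
  shows
    "((\<forall>i<N. y_rot i \<in> SO3) \<longrightarrow>
        has_sparse_pop SO3 (\<lambda>R. R) (rotation_residual y_rot) N \<beta> c) \<and>
     (sbar > 0 \<longrightarrow>
        has_sparse_pop (shape_models sbar) shape_value (shape_residual y_shape) N \<beta> c) \<and>
     (T > 0 \<longrightarrow>
        has_sparse_pop (rigid_models T) (\<lambda>m. m) (point_cloud_residual y_cloud) N \<beta> c) \<and>
     (T > 0 \<and> (\<forall>i<N. w i > 0) \<and>
      (\<forall>i<N. case y_mesh i of (a, u, b, v) \<Rightarrow> norm u = 1 \<and> norm v = 1) \<longrightarrow>
        has_sparse_pop (rigid_models T) (\<lambda>m. m) (mesh_residual w y_mesh) N \<beta> c)"
  using assms(2) rotation_pop shape_pop point_cloud_pop mesh_pop by simp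

end
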